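(* Let $\mathcal{A}$ be a finite alphabet, $n\ge1$, and let $X_0,X_1,\dots,X_{n-1}$ be arbitrary subsets of $\mathcal{A}^{\mathbb{N}}$. The prefix entropy of the $n$-fold interleaving $X=X_0\circledast X_1\circledast\cdots\circledast X_{n-1}$ is bounded above by the arithmetic mean of the prefix entropies of $X_0,\dots,X_{n-1}$. That is, $$H_p(X_0\circledast\cdots\circledast X_{n-1})\le\frac1n\sum_{i=0}^{n-1}H_p(X_i).$$
   Context: $\mathbb{N}=\{0,1,2,\dots\}$. The $n$-fold interleaving of sequences $\mathbf{x}_i=a_{i,0}a_{i,1}\cdots\in\mathcal{A}^{\mathbb{N}}$ ($0\le i\le n-1$) is $b_0b_1b_2\cdots$ with $b_{i+jn}=a_{i,j}$ ($0\le i\le n-1$, $j\ge0$); the $n$-fold interleaving $X_0\circledast\cdots\circledast X_{n-1}$ of sets is the set of all $n$-fold interleavings of $(\mathbf{x}_0,\dots,\mathbf{x}_{n-1})$ with $\mathbf{x}_i\in X_i$. For $X\subseteq\mathcal{A}^{\mathbb{N}}$, $N_k^I(X)$ is the number of distinct prefix blocks $b_0b_1\cdots b_{k-1}$ of length $k$ found across all words $b_0b_1b_2\cdots\in X$, and the prefix entropy is $H_p(X)=\limsup_{k\to\infty}\frac1k\log N_k^I(X)$ (natural logarithm). *)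

theory Defs
  imports "HOL-Analysis.Analysis"
begin

definition words :: "'a set \<Rightarrow> (nat \<Rightarrow> 'a) set" where
  "words A = UNIV \<rightarrow> A"

definition is_interleaving :: "nat \<Rightarrow> (nat \<Rightarrow> nat \<Rightarrow> 'a) \<Rightarrow> (nat \<Rightarrow> 'a) \<Rightarrow> bool" where
  "is_interleaving n x b \<longleftrightarrow> (\<forall>i<n. \<forall>j. b (i + j * n) = x i j)"

definition interleaving :: "nat \<Rightarrow> (nat \<Rightarrow> (nat \<Rightarrow> 'a) set) \<Rightarrow> (nat \<Rightarrow> 'a) set" where
  "interleaving n X = {b. \<exists>x. (\<forall>i<n. x i \<in> X i) \<and> is_interleaving n x b}"

text \<open>For \<open>n \<ge> 1\<close> the predicate determines the word \<open>b\<close>.\<close>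

lemma is_interleaving_iff:
  assumes "n \<ge> 1"
  shows "is_interleaving n x b \<longleftrightarrow> b = (\<lambda>m. x (m mod n) (m div n))"
proof
  assume b: "is_interleaving n x b"
  show "b = (\<lambda>m. x (m mod n) (m div n))"
  proof
    fix m
    have "m mod n < n"
      using assms by simp
    then have "b (m mod n + m div n * n) = x (m mod n) (m div n)"
      using b unfolding is_interleaving_def by blast
    then show "b m = x (m mod n) (m div n)"
      by (simp add: mod_div_mult_eq)
  qed
qed (use assms in \<open>auto simp: is_interleaving_def\<close>)

definition prefix_blocks :: "nat \<Rightarrow> (nat \<Rightarrow> 'a) set \<Rightarrow> 'a list set" where
  "prefix_blocks k X = (\<lambda>b. map b [0..<k]) ` X"

definition num_prefix_blocks :: "nat \<Rightarrow> (nat \<Rightarrow> 'a) set \<Rightarrow> nat" where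
  "num_prefix_blocks k X = card (prefix_blocks k X)"

text \<open>
  Over a finite alphabet the count is \<open>0\<close> only for the empty set of words. As the real logarithm satisfies \<open>ln 0 = 0\<close>,
  the convention \<open>log 0 = -\<infinity>\<close> has to be made explicit; it gives the empty set entropy \<open>-\<infinity>\<close>.
\<close>

definition log_count :: "nat \<Rightarrow> ereal" where
  "log_count N = (if N = 0 then -\<infinity> else ereal (ln (real N)))"

definition prefix_entropy :: "(nat \<Rightarrow> 'a) set \<Rightarrow> ereal" where
  "prefix_entropy X = limsup (\<lambda>k. ereal (1 / real k) * log_count (num_prefix_blocks k X))"

end

theory Submission
  imports Defs
begin

text \<open>
  The first \<open>k\<close> letters of an interleaving are determined by the first \<open>m = k div n + 1\<close> letters of each
  factor, so \<open>N\<^sub>k(X) \<le> \<Prod>i<n. N\<^sub>m(X\<^sub>i)\<close>. Taking logarithms and dividing by \<open>k\<close>, the claim follows from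
  \<open>m / k \<longlonglongrightarrow> 1 / n\<close> and the subadditivity of the limit superior. With the convention
  \<open>log 0 = -\<infinity>\<close> every step also holds for empty factors.
\<close>

lemma log_count_mono: "M \<le> N \<Longrightarrow> log_count M \<le> log_count N"
  by (auto simp: log_count_def)

text \<open>With -\<infinity> at 0 the law survives a zero factor: \<open>log_count\<close> never
  equals \<infinity>, so -\<infinity> absorbs every other summand.\<close>

lemma log_count_mult: "log_count (M * N) = log_count M + log_count N"
  by (auto simp: log_count_def ln_mult)

lemma log_count_prod: "finite S \<Longrightarrow> log_count (\<Prod>i\<in>S. N i) = (\<Sum>i\<in>S. log_count (N i))"
  by (induction S rule: finite_induct) (auto simp: log_count_mult, simp add: log_count_def)

lemma finite_prefix_blocks:
  assumes "finite A" "X \<subseteq> words A"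
  shows "finite (prefix_blocks k X)"
proof (rule finite_subset)
  show "prefix_blocks k X \<subseteq> {xs. set xs \<subseteq> A \<and> length xs = k}"
    using assms(2) by (fastforce simp: prefix_blocks_def words_def)
  show "finite {xs. set xs \<subseteq> A \<and> length xs = k}"
    using assms(1) by (rule finite_lists_length_eq)
qed

lemma num_prefix_blocks_interleaving_le:
  assumes "n \<ge> 1" and fin: "\<And>i. i < n \<Longrightarrow> finite (prefix_blocks (k div n + 1) (X i))"
  shows "num_prefix_blocks k (interleaving n X)
    \<le> (\<Prod>i<n. num_prefix_blocks (k div n + 1) (X i))"
proof -
  let ?m = "k div n + 1"
  define P where "P = (\<Pi>\<^sub>E i\<in>{..<n}. prefix_blocks ?m (X i))"
  \<comment> \<open>\<open>\<phi>\<close> weaves a tuple of factor prefixes back together. As its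
    image of the finite set \<open>P\<close> covers all blocks, \<open>card P\<close> bounds their
    number.\<close>
  define \<phi> :: "(nat \<Rightarrow> 'a list) \<Rightarrow> 'a list"
    where "\<phi> F = map (\<lambda>t. F (t mod n) ! (t div n)) [0..<k]" for F
  have "finite P"
    unfolding P_def using fin by (auto intro: finite_PiE)
  moreover have "prefix_blocks k (interleaving n X) \<subseteq> \<phi> ` P"
  proof
    fix w assume "w \<in> prefix_blocks k (interleaving n X)"
    then obtain x where x: "\<And>i. i < n \<Longrightarrow> x i \<in> X i"
      and w: "w = map (\<lambda>t. x (t mod n) (t div n)) [0..<k]"
      using assms(1) by (auto simp: prefix_blocks_def interleaving_def is_interleaving_iff)
    define F where "F = (\<lambda>i\<in>{..<n}. map (x i) [0..<?m])"
    \<comment> \<open>The index \<open>t div n\<close> reaches \<open>k div n\<close> when 0 < k and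
      n does not divide k, whence the + 1 in \<open>?m\<close>.\<close>
    have "t div n < ?m" if "t < k" for t
      using div_le_mono[of t k n] that by simp
    then have "\<phi> F = w"
      using assms(1) by (auto simp: \<phi>_def F_def w simp del: upt_Suc)
    moreover have "F \<in> P"
      using x by (auto simp: P_def F_def prefix_blocks_def simp del: upt_Suc)
    ultimately show "w \<in> \<phi> ` P"
      by blast
  qed
  ultimately have "card (prefix_blocks k (interleaving n X)) \<le> card P"
    by (rule surj_card_le)
  then show ?thesis
    by (simp add: P_def card_PiE num_prefix_blocks_def)
qed

text \<open>The image filter of \<open>f\<close> is finer than \<open>sequentially\<close>, so its
  \<open>Limsup\<close> is an infimum over more sets. Filters fit here because k div n + 1 repeats
  values for n \<ge> 2 and is no strictly increasing subsequence.\<close>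

lemma limsup_reindex_le:
  fixes u :: "nat \<Rightarrow> ereal"
  assumes "filterlim f sequentially sequentially"
  shows "limsup (\<lambda>k. u (f k)) \<le> limsup u"
proof -
  have "limsup (\<lambda>k. u (f k)) \<le> Limsup (filtermap f sequentially) u"
    by (rule Limsup_filtermap_ge)
  also have "\<dots> \<le> limsup u"
    unfolding Limsup_def
    using assms by (intro INF_superset_mono) (auto simp: filterlim_def le_filter_def)
  finally show ?thesis .
qed

text \<open>Mixed infinities do no harm: \<infinity> + (-\<infinity>) = \<infinity> in
  \<open>ereal\<close>, which makes the bound trivial.\<close>

lemma limsup_sum_le:
  fixes u :: "'i \<Rightarrow> nat \<Rightarrow> ereal"
  assumes "finite S"
  shows "limsup (\<lambda>k. \<Sum>i\<in>S. u i k) \<le> (\<Sum>i\<in>S. limsup (u i))"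
  using assms
proof (induction S rule: finite_induct)
  case (insert i S)
  then show ?case
    using ereal_limsup_add_mono[of "u i" "\<lambda>k. \<Sum>i\<in>S. u i k"]
    by (auto intro: order_trans add_left_mono)
qed (simp add: Limsup_const)

lemma tendsto_div_Suc_over:
  assumes "n \<ge> 1"
  shows "(\<lambda>k. real (k div n + 1) / real k) \<longlonglongrightarrow> 1 / real n"
proof (rule tendsto_sandwich)
  have lower: "real k / real n \<le> real (k div n + 1)" for k
    using less_imp_le[OF dividend_less_div_times[of n k]] assms
    by (simp add: divide_le_eq algebra_simps flip: of_nat_mult of_nat_add of_nat_Suc)
  \<comment> \<open>This fails at k = 0, where division by zero makes the quotient 0.\<close>
  show "\<forall>\<^sub>F k in sequentially. 1 / real n \<le> real (k div n + 1) / real k"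
    using eventually_gt_at_top[of 0] by eventually_elim (use lower assms in \<open>simp add: field_simps\<close>)
  have upper: "real (k div n + 1) \<le> real k / real n + 1" for k
    using of_nat_div_le_of_nat[of k n, where 'a = real] by simp
  show "\<forall>\<^sub>F k in sequentially. real (k div n + 1) / real k \<le> 1 / real n + 1 / real k"
    using eventually_gt_at_top[of 0]
  proof eventually_elim
    case (elim k)
    have "real (k div n + 1) / real k \<le> (real k / real n + 1) / real k"
      by (rule divide_right_mono[OF upper]) simp
    also have "\<dots> = 1 / real n + 1 / real k"
      using elim by (simp add: add_divide_distrib)
    finally show ?case .
  qed
  show "(\<lambda>k. 1 / real n + 1 / real k) \<longlonglongrightarrow> 1 / real n"
    using tendsto_add[OF tendsto_const lim_1_over_n] by simp
qed simp

theorem theorem2p18: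
  fixes A :: "'a set" and n :: nat and X :: "nat \<Rightarrow> (nat \<Rightarrow> 'a) set"
  assumes "finite A"
    and "n \<ge> 1"
    and "\<And>i. i < n \<Longrightarrow> X i \<subseteq> words A"
  shows "prefix_entropy (interleaving n X)
           \<le> ereal (1 / real n) * (\<Sum>i = 0..n - 1. prefix_entropy (X i))"
proof -
  define m where "m k = k div n + 1" for k
  define v where "v i l = ereal (1 / real l) * log_count (num_prefix_blocks l (X i))" for i l
  have bound: "ereal (1 / real k) * log_count (num_prefix_blocks k (interleaving n X))
      \<le> ereal (real (m k) / real k) * (\<Sum>i<n. v i (m k))" for k
  proof -
    have "log_count (num_prefix_blocks k (interleaving n X))
        \<le> log_count (\<Prod>i<n. num_prefix_blocks (m k) (X i))"
      unfolding m_def using assms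
      by (intro log_count_mono num_prefix_blocks_interleaving_le finite_prefix_blocks)
    also have "\<dots> = (\<Sum>i<n. log_count (num_prefix_blocks (m k) (X i)))"
      by (simp add: log_count_prod)
    finally have "ereal (1 / real k) * log_count (num_prefix_blocks k (interleaving n X))
        \<le> ereal (1 / real k) * (\<Sum>i<n. log_count (num_prefix_blocks (m k) (X i)))"
      by (rule ereal_mult_left_mono) simp
    \<comment> \<open>The factor \<open>m k\<close> cancels because it is positive. At k = 0 both
      sides are 0, since 1 / 0 = 0 and 0 * (-\<infinity>) = 0.\<close>
    also have "\<dots> = ereal (real (m k) / real k) *
        (ereal (1 / real (m k)) * (\<Sum>i<n. log_count (num_prefix_blocks (m k) (X i))))"
      by (simp add: mult.assoc[symmetric] m_def)
    also have "ereal (1 / real (m k)) * (\<Sum>i<n. log_count (num_prefix_blocks (m k) (X i)))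
        = (\<Sum>i<n. v i (m k))"
      unfolding v_def by (subst (1 2) mult.commute, rule sum_distrib_right_ereal) simp
    finally show ?thesis .
  qed
  have m_top: "filterlim m sequentially sequentially"
    unfolding m_def filterlim_at_top
  proof
    fix Z
    show "\<forall>\<^sub>F k in sequentially. Z \<le> k div n + 1"
      using eventually_ge_at_top[of "Z * n"]
    proof eventually_elim
      case (elim k)
      then show ?case
        using div_le_mono[OF elim, of n] assms(2) by simp
    qed
  qed
  have "prefix_entropy (interleaving n X)
      \<le> limsup (\<lambda>k. ereal (real (m k) / real k) * (\<Sum>i<n. v i (m k)))"
    unfolding prefix_entropy_def by (intro Limsup_mono always_eventually allI bound)
  \<comment> \<open>A factor with a positive finite limit can be pulled out of the limit superior,
    even if the latter is -\<infinity>.\<close>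
  also have "\<dots> = ereal (1 / real n) * limsup (\<lambda>k. \<Sum>i<n. v i (m k))"
    using assms(2) tendsto_div_Suc_over[OF assms(2)]
    by (intro ereal_limsup_lim_mult) (auto simp: m_def)
  also have "\<dots> \<le> ereal (1 / real n) * (\<Sum>i<n. limsup (v i))"
  proof (rule ereal_mult_left_mono)
    have "limsup (\<lambda>k. \<Sum>i<n. v i (m k)) \<le> limsup (\<lambda>l. \<Sum>i<n. v i l)"
      by (rule limsup_reindex_le[OF m_top])
    also have "\<dots> \<le> (\<Sum>i<n. limsup (v i))"
      by (rule limsup_sum_le) simp
    finally show "limsup (\<lambda>k. \<Sum>i<n. v i (m k)) \<le> (\<Sum>i<n. limsup (v i))" .
  qed simp
  \<comment> \<open>The index sets agree because n \<ge> 1; for n = 0 truncated subtraction would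
    leave the index 0.\<close>
  also have "(\<Sum>i<n. limsup (v i)) = (\<Sum>i = 0..n - 1. prefix_entropy (X i))"
    unfolding prefix_entropy_def v_def using assms(2) by (intro sum.cong) auto
  finally show ?thesis .
qed

end
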